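(* Fix an arbitrary pair of an $\mathsf E$-strictly concave valuation $\mathsf V^{(1)}$ and a concave valuation $\mathsf V^{(2)}$. Then, for any $\lambda$ with $0<\lambda\le1$, the valuation $\mathsf V=\lambda\,\mathsf V^{(1)}+(1-\lambda)\,\mathsf V^{(2)}$ is $\mathsf E$-strictly concave.
   Context: A game with $n\ge2$ players has finite strategy sets $S_i$ and cost functions $\mu_i:\mathcal S=\prod_{i\in[n]}S_i\to\mathbb R$. $\Delta(S_i)$ is the set of mixed strategies. A mixed profile $\mathbf p=\langle p_1,\dots,p_n\rangle$ induces $\mathbf p(\mathbf s)=\prod_i p_i(s_i)$; $\mathbf p_{-i}$ is $\mathbf p$ with $p_i$ removed. A valuation $\mathsf V=\langle\mathsf V_1,\dots,\mathsf V_n\rangle$ assigns real numbers $\mathsf V_i(\mathbf p)$ to every mixed profile, with $\mathsf V_i(\mathbf p)=\mu_i(\mathbf s)$ if $\mathbf p$ is a pure profile $\mathbf s$. $\mathsf E_i(\mathbf p)=\sum_{\mathbf s}\mathbf p(\mathbf s)\mu_i(\mathbf s)$. An $(\mathsf E+\mathsf R)$-valuation is a valuation of the form $\mathsf V=\mathsf E+\mathsf R$, where $\mathsf R$ is continuous and has the Risk-Positivity property: for each player $i$ and mixed profile $\mathbf p$, $\mathsf R_i(\mathbf p)\ge0$, and $\mathsf R_i(\mathbf p)=0$ if and only if $\mu_i(\mathbf s)$ remains constant over all profiles $\mathbf s$ with $\mathbf p(\mathbf s)>0$ (in which case $\mathsf V_i(\mathbf p)=\mathsf E_i(\mathbf p)=\mu_i(\mathbf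 s)$ for any such $\mathbf s$). A valuation is concave if, for each player $i$ and fixed $\mathbf p_{-i}$, $\mathsf V_i(\cdot,\mathbf p_{-i})$ is a concave function of the mixed strategy $p_i\in\Delta(S_i)$. For a player $i$, an $(\mathsf E+\mathsf R)$-valuation $\mathsf V_i$ is $\mathsf E$-strictly concave if for every game the following hold for a fixed partial mixed profile $\mathbf p_{-i}$: (1) $\mathsf V_i$ is concave in the mixed strategy $p_i$; (2) for a pair of mixed strategies $p_i',p_i''\in\Delta(S_i)$, if $\mathsf E_i(p_i',\mathbf p_{-i})\ne\mathsf E_i(p_i'',\mathbf p_{-i})$, then for any $\lambda$ with $0<\lambda<1$, $\mathsf V_i(\lambda p_i'+(1-\lambda)p_i'',\mathbf p_{-i})>\lambda\mathsf V_i(p_i',\mathbf p_{-i})+(1-\lambda)\mathsf V_i(p_i'',\mathbf p_{-i})$. A valuation $\mathsf V$ is $\mathsf E$-strictly concave if $\mathsf V_i$ is, for each player $i$.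
   Formalization: For a concave V^(2), V is shown to be a valuation satisfying (1) and (2); that V is also an (E+R)-valuation is shown only if V^(2) is one, since it fails in general, e.g. for V^(2)_i = E_i + Σ_a p_i(a)(1−p_i(a)) with constant costs and λ<1. *)

theory Defs
  imports "HOL-Analysis.Analysis"
begin

text \<open>Players are the numbers in \<open>{1..n}\<close>. Profiles and cost functions are extensional
  functions (\<open>PiE\<close>), so that each game and each (mixed) profile has exactly one representation.\<close>

record 's game =
  strategies :: "nat \<Rightarrow> 's set"
  cost :: "nat \<Rightarrow> (nat \<Rightarrow> 's) \<Rightarrow> real"

definition profiles :: "nat \<Rightarrow> 's game \<Rightarrow> (nat \<Rightarrow> 's) set" where
  "profiles n G = PiE {1..n} (strategies G)"

definition is_game :: "nat \<Rightarrow> 's game \<Rightarrow> bool" where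
  "is_game n G \<longleftrightarrow>
     strategies G \<in> {1..n} \<rightarrow>\<^sub>E {S. finite S \<and> S \<noteq> {}} \<and>
     cost G \<in> {1..n} \<rightarrow>\<^sub>E (profiles n G \<rightarrow>\<^sub>E UNIV)"

text \<open>A mixed strategy vanishes outside the strategy set.\<close>

definition mixed_strategies :: "'s set \<Rightarrow> ('s \<Rightarrow> real) set" where
  "mixed_strategies S =
     {q. (\<forall>x\<in>S. 0 \<le> q x) \<and> (\<forall>x. x \<notin> S \<longrightarrow> q x = 0) \<and> (\<Sum>x\<in>S. q x) = 1}"

definition mixed_profiles :: "nat \<Rightarrow> 's game \<Rightarrow> (nat \<Rightarrow> 's \<Rightarrow> real) set" where
  "mixed_profiles n G = (\<Pi>\<^sub>E i\<in>{1..n}. mixed_strategies (strategies G i))"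

text \<open>The partial mixed profiles \<open>p\<^sub>-\<^sub>i\<close>; the full profile \<open>(q, p\<^sub>-\<^sub>i)\<close> is then \<open>p(i := q)\<close>.\<close>

definition partial_mixed_profiles :: "nat \<Rightarrow> 's game \<Rightarrow> nat \<Rightarrow> (nat \<Rightarrow> 's \<Rightarrow> real) set" where
  "partial_mixed_profiles n G i = (\<Pi>\<^sub>E j\<in>{1..n} - {i}. mixed_strategies (strategies G j))"

definition pure :: "nat \<Rightarrow> (nat \<Rightarrow> 's) \<Rightarrow> nat \<Rightarrow> 's \<Rightarrow> real" where
  "pure n s = (\<lambda>i\<in>{1..n}. indicator {s i})"

definition profile_prob :: "nat \<Rightarrow> (nat \<Rightarrow> 's \<Rightarrow> real) \<Rightarrow> (nat \<Rightarrow> 's) \<Rightarrow> real" where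
  "profile_prob n p s = (\<Prod>i\<in>{1..n}. p i (s i))"

definition expected_cost :: "nat \<Rightarrow> 's game \<Rightarrow> nat \<Rightarrow> (nat \<Rightarrow> 's \<Rightarrow> real) \<Rightarrow> real" where
  "expected_cost n G i p = (\<Sum>s\<in>profiles n G. profile_prob n p s * cost G i s)"

text \<open>A valuation \<open>\<langle>V\<^sub>1, \<dots>, V\<^sub>n\<rangle>\<close> is a functional on all \<open>n\<close>-player games: \<open>V G i p\<close> is
  \<open>V\<^sub>i(p)\<close> in the game \<open>G\<close>.\<close>

type_synonym 's valuation = "'s game \<Rightarrow> nat \<Rightarrow> (nat \<Rightarrow> 's \<Rightarrow> real) \<Rightarrow> real"

definition is_valuation :: "nat \<Rightarrow> 's valuation \<Rightarrow> bool" where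
  "is_valuation n V \<longleftrightarrow>
     (\<forall>G. is_game n G \<longrightarrow> (\<forall>i\<in>{1..n}. \<forall>s\<in>profiles n G. V G i (pure n s) = cost G i s))"

text \<open>Continuity below refers to the product topology on \<open>nat \<Rightarrow> 's \<Rightarrow> real\<close>, which on the mixed
  profiles of a game coincides with the Euclidean topology, as only finitely many coordinates
  vary.\<close>

definition continuous_valuation :: "nat \<Rightarrow> 's valuation \<Rightarrow> bool" where
  "continuous_valuation n R \<longleftrightarrow>
     (\<forall>G. is_game n G \<longrightarrow> (\<forall>i\<in>{1..n}. continuous_on (mixed_profiles n G) (R G i)))"

definition risk_positive :: "nat \<Rightarrow> 's valuation \<Rightarrow> bool" where
  "risk_positive n R \<longleftrightarrow>
     (\<forall>G. is_game n G \<longrightarrow> (\<forall>i\<in>{1..n}. \<forall>p\<in>mixed_profiles n G.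
        0 \<le> R G i p \<and>
        (R G i p = 0 \<longleftrightarrow> cost G i constant_on {s \<in> profiles n G. 0 < profile_prob n p s})))"

definition ER_valuation :: "nat \<Rightarrow> 's valuation \<Rightarrow> bool" where
  "ER_valuation n V \<longleftrightarrow> is_valuation n V \<and>
     (\<exists>R. continuous_valuation n R \<and> risk_positive n R \<and>
        (\<forall>G. is_game n G \<longrightarrow> (\<forall>i\<in>{1..n}. \<forall>p\<in>mixed_profiles n G.
           V G i p = expected_cost n G i p + R G i p)))"

definition mix :: "real \<Rightarrow> ('s \<Rightarrow> real) \<Rightarrow> ('s \<Rightarrow> real) \<Rightarrow> 's \<Rightarrow> real" where
  "mix t q q' = (\<lambda>x. t * q x + (1 - t) * q' x)"

definition concave_for :: "nat \<Rightarrow> 's valuation \<Rightarrow> nat \<Rightarrow> bool" where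
  "concave_for n V i \<longleftrightarrow>
     (\<forall>G. is_game n G \<longrightarrow> (\<forall>p\<in>partial_mixed_profiles n G i.
        \<forall>q\<in>mixed_strategies (strategies G i). \<forall>q'\<in>mixed_strategies (strategies G i).
        \<forall>t. 0 \<le> t \<and> t \<le> 1 \<longrightarrow>
          t * V G i (p(i := q)) + (1 - t) * V G i (p(i := q')) \<le> V G i (p(i := mix t q q'))))"

definition concave_valuation :: "nat \<Rightarrow> 's valuation \<Rightarrow> bool" where
  "concave_valuation n V \<longleftrightarrow> is_valuation n V \<and> (\<forall>i\<in>{1..n}. concave_for n V i)"

text \<open>The two conditions that make an \<open>(E + R)\<close>-valuation \<open>E\<close>-strictly concave for player \<open>i\<close>.
  They make sense for every valuation.\<close>

definition E_strict_concavity_for :: "nat \<Rightarrow> 's valuation \<Rightarrow> nat \<Rightarrow> bool" where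
  "E_strict_concavity_for n V i \<longleftrightarrow>
     concave_for n V i \<and>
     (\<forall>G. is_game n G \<longrightarrow> (\<forall>p\<in>partial_mixed_profiles n G i.
        \<forall>q\<in>mixed_strategies (strategies G i). \<forall>q'\<in>mixed_strategies (strategies G i).
        expected_cost n G i (p(i := q)) \<noteq> expected_cost n G i (p(i := q')) \<longrightarrow>
        (\<forall>t. 0 < t \<and> t < 1 \<longrightarrow>
          V G i (p(i := mix t q q')) > t * V G i (p(i := q)) + (1 - t) * V G i (p(i := q')))))"

definition E_strictly_concave :: "nat \<Rightarrow> 's valuation \<Rightarrow> bool" where
  "E_strictly_concave n V \<longleftrightarrow>
     ER_valuation n V \<and> (\<forall>i\<in>{1..n}. E_strict_concavity_for n V i)"

definition combine :: "real \<Rightarrow> 's valuation \<Rightarrow> 's valuation \<Rightarrow> 's valuation" where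
  "combine l V W = (\<lambda>G i p. l * V G i p + (1 - l) * W G i p)"

end

theory Submission
  imports Defs
begin

text \<open>The concavity inequalities are linear in the valuation, so they may be added with
  weights \<open>l\<close> and \<open>1 - l\<close>. Whether strictness is demanded depends only on
  the expected costs, hence on the game and not on the valuation; where it is demanded, the strict
  inequality for \<open>V1\<close> has positive weight and survives adding the weak one for
  \<open>V2\<close> (\<open>E_strict_concavity_for_combine\<close>). If both valuations are E plus a
  risk term, so is the combination, with the combined risk (\<open>ER_valuation_combine\<close>,
  \<open>risk_positive_combine\<close>).\<close>

lemma is_valuation_combine:
  assumes "is_valuation n V" and "is_valuation n W"
  shows "is_valuation n (combine l V W)"
  using assms by (simp add: is_valuation_def combine_def algebra_simps)

text \<open>Interchanging the average over strategies with the average over valuations exposes the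
  separate inequalities for \<open>V\<close> and \<open>W\<close>, ready to be weighted.\<close>

lemma combine_mix:
  "t * combine l V W G i p + (1 - t) * combine l V W G i p' =
     l * (t * V G i p + (1 - t) * V G i p') + (1 - l) * (t * W G i p + (1 - t) * W G i p')"
  by (simp add: combine_def algebra_simps)

lemma concave_for_combine:
  fixes V W :: "'s valuation"
  assumes V: "concave_for n V i" and W: "concave_for n W i" and l: "0 \<le> l" "l \<le> 1"
  shows "concave_for n (combine l V W) i"
  unfolding concave_for_def combine_mix
proof (intro allI impI ballI)
  fix G :: "'s game" and p q q' and t :: real
  assume "is_game n G" "p \<in> partial_mixed_profiles n G i"
    "q \<in> mixed_strategies (strategies G i)" "q' \<in> mixed_strategies (strategies G i)"
    "0 \<le> t \<and> t \<le> 1"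
  then have "t * V G i (p(i := q)) + (1 - t) * V G i (p(i := q')) \<le> V G i (p(i := mix t q q'))"
    and "t * W G i (p(i := q)) + (1 - t) * W G i (p(i := q')) \<le> W G i (p(i := mix t q q'))"
    using V W unfolding concave_for_def by blast+
  then show "l * (t * V G i (p(i := q)) + (1 - t) * V G i (p(i := q'))) +
      (1 - l) * (t * W G i (p(i := q)) + (1 - t) * W G i (p(i := q')))
      \<le> combine l V W G i (p(i := mix t q q'))"
    unfolding combine_def using l by (intro add_mono mult_left_mono) auto
qed

lemma E_strict_concavity_for_combine:
  fixes V W :: "'s valuation"
  assumes V: "E_strict_concavity_for n V i" and W: "concave_for n W i" and l: "0 < l" "l \<le> 1"
  shows "E_strict_concavity_for n (combine l V W) i"
  unfolding E_strict_concavity_for_def combine_mix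
proof (intro conjI allI impI ballI)
  show "concave_for n (combine l V W) i"
    using V W l by (intro concave_for_combine) (auto simp: E_strict_concavity_for_def)
next
  fix G :: "'s game" and p q q' and t :: real
  assume *: "is_game n G" "p \<in> partial_mixed_profiles n G i"
    "q \<in> mixed_strategies (strategies G i)" "q' \<in> mixed_strategies (strategies G i)"
    and E: "expected_cost n G i (p(i := q)) \<noteq> expected_cost n G i (p(i := q'))"
    and t: "0 < t \<and> t < 1"
  have "t * V G i (p(i := q)) + (1 - t) * V G i (p(i := q')) < V G i (p(i := mix t q q'))"
    using V * E t unfolding E_strict_concavity_for_def by blast
  moreover have "t * W G i (p(i := q)) + (1 - t) * W G i (p(i := q')) \<le> W G i (p(i := mix t q q'))"
    using W * t unfolding concave_for_def by (meson less_imp_le)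
  ultimately show "l * (t * V G i (p(i := q)) + (1 - t) * V G i (p(i := q'))) +
      (1 - l) * (t * W G i (p(i := q)) + (1 - t) * W G i (p(i := q')))
      < combine l V W G i (p(i := mix t q q'))"
    unfolding combine_def using l
    \<comment> \<open>Strictness comes from \<open>V\<close> alone, through \<open>0 < l\<close>;
      the weight \<open>1 - l\<close> may be zero, so the \<open>W\<close> part contributes only a
      weak inequality.\<close>
    by (intro add_less_le_mono mult_strict_left_mono mult_left_mono) auto
qed

lemma continuous_valuation_combine:
  assumes "continuous_valuation n R" and "continuous_valuation n S"
  shows "continuous_valuation n (combine l R S)"
  using assms unfolding continuous_valuation_def combine_def
  by (auto intro!: continuous_intros)

text \<open>By risk positivity, \<open>R\<close> and \<open>S\<close> vanish at exactly the same
  mixed profiles, so a nonnegative combination with positive weight on \<open>R\<close> vanishes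
  there and nowhere else. This covers \<open>l = 1\<close>, where \<open>S\<close> drops
  out.\<close>

lemma risk_positive_combine:
  fixes R S :: "'s valuation"
  assumes R: "risk_positive n R" and S: "risk_positive n S" and l: "0 < l" "l \<le> 1"
  shows "risk_positive n (combine l R S)"
  unfolding risk_positive_def
proof (intro allI impI ballI)
  fix G :: "'s game" and i p
  assume *: "is_game n G" "i \<in> {1..n}" "p \<in> mixed_profiles n G"
  let ?const = "cost G i constant_on {s \<in> profiles n G. 0 < profile_prob n p s}"
  have R': "0 \<le> R G i p" "R G i p = 0 \<longleftrightarrow> ?const"
    and S': "0 \<le> S G i p" "S G i p = 0 \<longleftrightarrow> ?const"
    using R S * unfolding risk_positive_def by blast+
  have "0 \<le> l * R G i p" "0 \<le> (1 - l) * S G i p"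
    using R' S' l by simp_all
  moreover from this have "combine l R S G i p = 0 \<longleftrightarrow> l * R G i p = 0 \<and> (1 - l) * S G i p = 0"
    unfolding combine_def by (rule add_nonneg_eq_0_iff)
  ultimately show "0 \<le> combine l R S G i p \<and> (combine l R S G i p = 0 \<longleftrightarrow> ?const)"
    using R' S' l by (auto simp: combine_def)
qed

lemma ER_valuation_combine:
  assumes V: "ER_valuation n V" and W: "ER_valuation n W" and l: "0 < l" "l \<le> 1"
  shows "ER_valuation n (combine l V W)"
proof -
  obtain R where R: "continuous_valuation n R" "risk_positive n R"
    "\<And>G i p. is_game n G \<Longrightarrow> i \<in> {1..n} \<Longrightarrow> p \<in> mixed_profiles n G \<Longrightarrow>
      V G i p = expected_cost n G i p + R G i p"
    using V unfolding ER_valuation_def by blast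
  obtain S where S: "continuous_valuation n S" "risk_positive n S"
    "\<And>G i p. is_game n G \<Longrightarrow> i \<in> {1..n} \<Longrightarrow> p \<in> mixed_profiles n G \<Longrightarrow>
      W G i p = expected_cost n G i p + S G i p"
    using W unfolding ER_valuation_def by blast
  \<comment> \<open>The weights sum to 1, so the expected cost is reproduced exactly and
    \<open>combine l R S\<close> is the risk term.\<close>
  have "combine l V W G i p = expected_cost n G i p + combine l R S G i p"
    if "is_game n G" "i \<in> {1..n}" "p \<in> mixed_profiles n G" for G i p
    unfolding combine_def R(3)[OF that] S(3)[OF that] by (simp add: algebra_simps)
  moreover have "is_valuation n (combine l V W)"
    using V W by (intro is_valuation_combine) (auto simp: ER_valuation_def)
  ultimately show ?thesis
    using continuous_valuation_combine[OF R(1) S(1)] risk_positive_combine[OF R(2) S(2) l]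
    unfolding ER_valuation_def by blast
qed

text \<open>The last conjunct is conditional because \<open>E_strictly_concave\<close> includes the
  E + R form, which a merely concave \<open>V2\<close> may destroy: E plus the entropy of the mixed
  strategies is concave and agrees with the cost at pure profiles, yet can be positive in excess of
  E when the cost is constant.\<close>

theorem corollary2p2:
  fixes n :: nat and V1 V2 :: "'s valuation" and l :: real
  assumes "2 \<le> n"
    and "E_strictly_concave n V1"
    and "concave_valuation n V2"
    and "0 < l" and "l \<le> 1"
  shows "is_valuation n (combine l V1 V2)
    \<and> (\<forall>i\<in>{1..n}. E_strict_concavity_for n (combine l V1 V2) i)
    \<and> (ER_valuation n V2 \<longrightarrow> E_strictly_concave n (combine l V1 V2))"
proof -
  have V1: "ER_valuation n V1" "\<forall>i\<in>{1..n}. E_strict_concavity_for n V1 i"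
    using assms(2) by (simp_all add: E_strictly_concave_def)
  have V2: "is_valuation n V2" "\<forall>i\<in>{1..n}. concave_for n V2 i"
    using assms(3) by (simp_all add: concave_valuation_def)
  have "is_valuation n (combine l V1 V2)"
    using V1(1) V2(1) by (simp add: ER_valuation_def is_valuation_combine)
  moreover have "\<forall>i\<in>{1..n}. E_strict_concavity_for n (combine l V1 V2) i"
    using V1(2) V2(2) assms(4,5) by (blast intro: E_strict_concavity_for_combine)
  ultimately show ?thesis
    using ER_valuation_combine[OF V1(1) _ assms(4,5)] by (simp add: E_strictly_concave_def)
qed

end
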